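(* For integers $b>a\geq 1$ and every integer $\beta\geq 2$, $$\binom{b+\beta a}{b} \, \geq \, \binom{a+\beta b}{a} \, .$$
   Context: $\binom{m}{n}$ denotes the usual binomial coefficient. *)

theory Defs
  imports Complex_Main
begin

end

theory Submission
  imports Defs
begin

text \<open>
  Passing from \<open>\<beta>\<close> to \<open>\<beta> + 1\<close> multiplies the left-hand side by \<open>R (\<beta> a)\<close> and the
  right-hand side by \<open>R (\<beta> b)\<close>, where
  \<open>R n = (n + a + b)! n! / ((n + a)! (n + b)!)\<close> is symmetric in \<open>a\<close> and \<open>b\<close> and antitone
  in \<open>n\<close>. Both sides are \<open>1\<close> at \<open>\<beta> = 0\<close>, so the inequality follows by induction on \<open>\<beta>\<close>.
\<close>

definition binomial_step :: "nat \<Rightarrow> nat \<Rightarrow> nat \<Rightarrow> real" where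
  "binomial_step a b n = fact (n + a + b) * fact n / (fact (n + a) * fact (n + b))"

lemma binomial_step_commute: "binomial_step a b n = binomial_step b a n"
  by (simp add: binomial_step_def ac_simps)

lemma binomial_step_nonneg: "0 \<le> binomial_step a b n"
  by (simp add: binomial_step_def)

text \<open>Consecutive values have ratio \<open>?u / ?v\<close>, and
  \<open>?v - ?u = a * b \<ge> 0\<close>.\<close>

lemma binomial_step_antimono: "antimono (binomial_step a b)"
proof (rule decseq_SucI)
  fix n
  let ?u = "real (n + 1 + a + b) * real (n + 1)"
  let ?v = "real (n + 1 + a) * real (n + 1 + b)"
  have "binomial_step a b (Suc n) = binomial_step a b n * (?u / ?v)"
    by (simp add: binomial_step_def ac_simps)
  also have "\<dots> \<le> binomial_step a b n * 1"
  proof (intro mult_left_mono binomial_step_nonneg)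
    have "?u \<le> ?v"
      by (simp add: algebra_simps)
    moreover have "?v > 0"
      by (intro mult_pos_pos) auto
    ultimately show "?u / ?v \<le> 1"
      by simp
  qed
  finally show "binomial_step a b (Suc n) \<le> binomial_step a b n"
    by simp
qed

text \<open>Both binomials carry the same \<open>b!\<close> in the denominator; it cancels in their
  quotient.\<close>

lemma binomial_add_step:
  "real ((b + (n + a)) choose b) = binomial_step a b n * real ((b + n) choose b)"
  by (simp add: binomial_fact binomial_step_def add_ac)

lemma binomial_add_mult_le:
  fixes a b \<beta> :: nat
  assumes "a \<le> b"
  shows "(a + \<beta> * b) choose a \<le> (b + \<beta> * a) choose b"
proof (induction \<beta>)
  case (Suc \<beta>)
  have "real ((a + Suc \<beta> * b) choose a) = binomial_step b a (\<beta> * b) * real ((a + \<beta> * b) choose a)"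
    using binomial_add_step[of a "\<beta> * b" b] by (simp add: add_ac)
  also have "\<dots> \<le> binomial_step a b (\<beta> * a) * real ((b + \<beta> * a) choose b)"
    \<comment> \<open>By symmetry both factors are values of the one antitone function
      \<open>binomial_step a b\<close>, compared at
      \<open>\<beta> * a \<le> \<beta> * b\<close>.\<close>
    unfolding binomial_step_commute[of b a]
    using Suc.IH assms
    by (intro mult_mono antimonoD[OF binomial_step_antimono] binomial_step_nonneg) auto
  also have "\<dots> = real ((b + Suc \<beta> * a) choose b)"
    using binomial_add_step[of b "\<beta> * a" a] by (simp add: add_ac)
  finally show ?case
    by linarith
qed simp

theorem theorem5:
  fixes a b \<beta> :: nat
  assumes "b > a" and "a \<ge> 1" and "\<beta> \<ge> 2"
  shows "(b + \<beta> * a) choose b \<ge> (a + \<beta> * b) choose a"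
  using assms by (intro binomial_add_mult_le) simp

end
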